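(* Let $n$ be a positive integer. The Zariski closure of $\mathcal{P}_{(n,n,2),2}(\mathbb{C})$ is the entire ambient space $S^2(\mathbb{C}^n)\times S^2(\mathbb{C}^n)$.
   Context: $S^2(\mathbb{C}^n)$ denotes the complex vector space of homogeneous polynomials of degree $2$ in $x_1,\dots,x_n$ (equivalently, symmetric $n\times n$ complex matrices), regarded as an affine space with its Zariski topology. The neuromanifold $\mathcal{P}_{(n,n,2),2}(\mathbb{C})\subseteq S^2(\mathbb{C}^n)\times S^2(\mathbb{C}^n)$ is the set of all pairs $(f_1,f_2)$ of the form $$f_i=\sum_{s=1}^n b_{is}(a_{s1}x_1+\dots+a_{sn}x_n)^2,\qquad i=1,2,$$ with $(a_{sj})\in\mathbb{C}^{n\times n}$ and $(b_{is})\in\mathbb{C}^{2\times n}$ arbitrary. *)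

theory Defs
  imports "HOL-Analysis.Analysis" "HOL-Library.Poly_Mapping"
begin

text \<open>Complex polynomials in variables indexed by a finite type \<open>'n\<close>, as the monoid algebra of
  the exponent vectors; multiplication is the convolution product of \<open>Poly_Mapping\<close>.\<close>

type_synonym 'n cpoly = "('n \<Rightarrow>\<^sub>0 nat) \<Rightarrow>\<^sub>0 complex"

definition Const :: "complex \<Rightarrow> 'n cpoly" where
  "Const c = Poly_Mapping.single 0 c"

definition Var :: "'n \<Rightarrow> 'n cpoly" where
  "Var j = Poly_Mapping.single (Poly_Mapping.single j 1) 1"

definition monomial_degree :: "('n::finite \<Rightarrow>\<^sub>0 nat) \<Rightarrow> nat" where
  "monomial_degree m = (\<Sum>j\<in>UNIV. Poly_Mapping.lookup m j)"

definition S2 :: "('n::finite) cpoly set" where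
  "S2 = {f. \<forall>m\<in>Poly_Mapping.keys f. monomial_degree m = 2}"

definition neuromanifold :: "(('n::finite) cpoly \<times> 'n cpoly) set" where
  "neuromanifold =
     {(\<Sum>s\<in>UNIV. Const (b $ 1 $ s) * (\<Sum>j\<in>UNIV. Const (a $ s $ j) * Var j) ^ 2,
       \<Sum>s\<in>UNIV. Const (b $ 2 $ s) * (\<Sum>j\<in>UNIV. Const (a $ s $ j) * Var j) ^ 2)
      | (a :: complex ^ 'n ^ 'n) (b :: complex ^ 'n ^ 2). True}"

text \<open>Polynomial functions of a pair of polynomials: the algebra generated by the coefficient
  functions. On \<open>S2 \<times> S2\<close> the coefficients of monomials of degree 2 form a linear coordinate system
  and all the other coefficients vanish.\<close>

inductive poly_fun :: "('n cpoly \<times> 'n cpoly \<Rightarrow> complex) \<Rightarrow> bool" where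
  const: "poly_fun (\<lambda>_. c)"
| coeff_fst: "poly_fun (\<lambda>p. Poly_Mapping.lookup (fst p) m)"
| coeff_snd: "poly_fun (\<lambda>p. Poly_Mapping.lookup (snd p) m)"
| add: "poly_fun F \<Longrightarrow> poly_fun G \<Longrightarrow> poly_fun (\<lambda>p. F p + G p)"
| mult: "poly_fun F \<Longrightarrow> poly_fun G \<Longrightarrow> poly_fun (\<lambda>p. F p * G p)"

definition zero_locus ::
  "(('n::finite) cpoly \<times> 'n cpoly \<Rightarrow> complex) set \<Rightarrow> ('n cpoly \<times> 'n cpoly) set" where
  "zero_locus \<F> = {p \<in> S2 \<times> S2. \<forall>F\<in>\<F>. F p = 0}"

definition zariski_closed :: "(('n::finite) cpoly \<times> 'n cpoly) set \<Rightarrow> bool" where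
  "zariski_closed Z \<longleftrightarrow> (\<exists>\<F>. (\<forall>F\<in>\<F>. poly_fun F) \<and> Z = zero_locus \<F>)"

definition zariski :: "(('n::finite) cpoly \<times> 'n cpoly) topology" where
  "zariski = topology (\<lambda>U. U \<subseteq> S2 \<times> S2 \<and> zariski_closed (S2 \<times> S2 - U))"

lemma zariski_closed_Un:
  assumes "zariski_closed Y" "zariski_closed Z"
  shows "zariski_closed (Y \<union> Z)"
proof -
  obtain \<F> where F: "\<forall>F\<in>\<F>. poly_fun F" "Y = zero_locus \<F>"
    using assms(1) unfolding zariski_closed_def by blast
  obtain \<G> where G: "\<forall>G\<in>\<G>. poly_fun G" "Z = zero_locus \<G>"
    using assms(2) unfolding zariski_closed_def by blast
  let ?H = "{\<lambda>p. F p * G p | F G. F \<in> \<F> \<and> G \<in> \<G>}"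
  have "Y \<union> Z = zero_locus ?H"
  proof (rule set_eqI)
    fix p
    show "p \<in> Y \<union> Z \<longleftrightarrow> p \<in> zero_locus ?H"
    proof
      assume "p \<in> Y \<union> Z"
      then show "p \<in> zero_locus ?H"
        unfolding F(2) G(2) zero_locus_def by auto
    next
      assume p: "p \<in> zero_locus ?H"
      then have pS: "p \<in> S2 \<times> S2" unfolding zero_locus_def by blast
      have all: "\<forall>H\<in>?H. H p = 0"
        using p unfolding zero_locus_def mem_Collect_eq by (rule conjunct2)
      have prod: "F p * G p = 0" if "F \<in> \<F>" "G \<in> \<G>" for F G
      proof -
        have "(\<lambda>p. F p * G p) \<in> ?H" using that by blast
        then show ?thesis by (rule bspec[OF all])
      qed
      show "p \<in> Y \<union> Z"
      proof (rule ccontr)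
        assume "p \<notin> Y \<union> Z"
        then obtain F G where "F \<in> \<F>" "F p \<noteq> 0" "G \<in> \<G>" "G p \<noteq> 0"
          using pS unfolding F(2) G(2) zero_locus_def by blast
        then show False using prod[of F G] by simp
      qed
    qed
  qed
  moreover have "\<forall>H\<in>?H. poly_fun H" using F(1) G(1) poly_fun.mult by blast
  ultimately show ?thesis unfolding zariski_closed_def by blast
qed

lemma zariski_closed_Inter:
  assumes "\<And>Z. Z \<in> \<K> \<Longrightarrow> zariski_closed Z"
  shows "zariski_closed (S2 \<times> S2 \<inter> \<Inter>\<K>)"
proof -
  have "\<forall>Z\<in>\<K>. \<exists>\<F>. (\<forall>F\<in>\<F>. poly_fun F) \<and> Z = zero_locus \<F>"
    using assms unfolding zariski_closed_def by blast
  then obtain f where f: "\<forall>Z\<in>\<K>. (\<forall>F\<in>f Z. poly_fun F) \<and> Z = zero_locus (f Z)"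
    by (rule bchoice[THEN exE])
  have mem: "p \<in> Z \<longleftrightarrow> p \<in> S2 \<times> S2 \<and> (\<forall>F\<in>f Z. F p = 0)" if "Z \<in> \<K>" for Z p
    using f that unfolding zero_locus_def by blast
  have "S2 \<times> S2 \<inter> \<Inter>\<K> = zero_locus (\<Union>(f ` \<K>))"
  proof (rule set_eqI)
    fix p
    show "p \<in> S2 \<times> S2 \<inter> \<Inter>\<K> \<longleftrightarrow> p \<in> zero_locus (\<Union>(f ` \<K>))"
      unfolding zero_locus_def using mem[of _ p] by blast
  qed
  moreover have "\<forall>F\<in>\<Union>(f ` \<K>). poly_fun F" using f by blast
  ultimately show ?thesis unfolding zariski_closed_def by blast
qed

lemma zariski_closed_empty: "zariski_closed {}"
proof -
  have "{} = zero_locus {\<lambda>_. 1}" unfolding zero_locus_def by simp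
  moreover have "\<forall>F\<in>{\<lambda>_. 1}. poly_fun F" using poly_fun.const by blast
  ultimately show ?thesis unfolding zariski_closed_def by blast
qed

lemma istopology_zariski:
  "istopology (\<lambda>U. U \<subseteq> S2 \<times> S2 \<and> zariski_closed (S2 \<times> S2 - U))"
  unfolding istopology_def
proof (intro conjI allI impI)
  fix U V :: "('a cpoly \<times> 'a cpoly) set"
  assume U: "U \<subseteq> S2 \<times> S2 \<and> zariski_closed (S2 \<times> S2 - U)"
    and V: "V \<subseteq> S2 \<times> S2 \<and> zariski_closed (S2 \<times> S2 - V)"
  then show "U \<inter> V \<subseteq> S2 \<times> S2" by blast
  show "zariski_closed (S2 \<times> S2 - U \<inter> V)"
    using zariski_closed_Un[of "S2 \<times> S2 - U" "S2 \<times> S2 - V"] U V by (simp add: Diff_Int)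
next
  fix \<U> :: "('a cpoly \<times> 'a cpoly) set set"
  assume U: "\<forall>U\<in>\<U>. U \<subseteq> S2 \<times> S2 \<and> zariski_closed (S2 \<times> S2 - U)"
  then show "\<Union>\<U> \<subseteq> S2 \<times> S2" by blast
  have eq: "S2 \<times> S2 - \<Union>\<U> = S2 \<times> S2 \<inter> \<Inter>((\<lambda>U. S2 \<times> S2 - U) ` \<U>)" by blast
  show "zariski_closed (S2 \<times> S2 - \<Union>\<U>)"
    unfolding eq by (rule zariski_closed_Inter) (use U in blast)
qed

lemma openin_zariski:
  "openin zariski U \<longleftrightarrow> U \<subseteq> S2 \<times> S2 \<and> zariski_closed (S2 \<times> S2 - U)"
  unfolding zariski_def topology_inverse'[OF istopology_zariski] ..

lemma topspace_zariski: "topspace zariski = S2 \<times> S2"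
proof
  show "topspace zariski \<subseteq> S2 \<times> S2"
    unfolding topspace_def openin_zariski by blast
  have "openin zariski (S2 \<times> S2)"
    unfolding openin_zariski Diff_cancel using zariski_closed_empty by blast
  then show "S2 \<times> S2 \<subseteq> topspace zariski" by (rule openin_subset)
qed

lemma closedin_zariski: "closedin zariski Z \<longleftrightarrow> zariski_closed Z"
proof -
  have "zariski_closed Z \<Longrightarrow> Z \<subseteq> S2 \<times> S2"
    unfolding zariski_closed_def zero_locus_def by blast
  then show ?thesis
    unfolding closedin_def topspace_zariski openin_zariski
    by (metis Diff_subset double_diff subset_refl)
qed

end

theory Submission
  imports Defs "HOL-Computational_Algebra.Polynomial"
begin

text \<open>A pair of real quadratic forms, the first of them positive definite, is simultaneously
  diagonalizable by congruence, hence lies in the neuromanifold. Given symmetric complex matrices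
  \<open>M = X + \<i> Y\<close> and \<open>M' = X' + \<i> Y'\<close>, consider the quadratic curve
  \<open>z \<mapsto> (1 + z Y + z\<^sup>2 (1 - X), z Y' - z\<^sup>2 X')\<close>. For small real \<open>z\<close> it consists of such real pairs, and
  at \<open>z = \<i>\<close> it passes through \<open>(M, M')\<close>. A polynomial function vanishing on the neuromanifold restricts
  to a polynomial in \<open>z\<close> with infinitely many zeros, so it also vanishes at \<open>(M, M')\<close>.\<close>

section \<open>Simultaneous diagonalization of two real symmetric bilinear forms\<close>

lemma linear_term_zero_if_quadratic_nonneg:
  fixes a b :: real
  assumes "\<And>t. 0 \<le> 2 * t * a + t\<^sup>2 * b"
  shows "a = 0"
proof (rule ccontr)
  assume "a \<noteq> 0"
  \<comment> \<open>A strictly positive upper bound of \<open>b\<close>: the majorant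
    \<open>2 * t * a + t\<^sup>2 * c\<close> has its minimum \<open>- (a\<^sup>2 / c)\<close> at
    \<open>t = - a / c\<close>.\<close>
  define c where "c = \<bar>b\<bar> + 1"
  have c: "c > 0" "b \<le> c" unfolding c_def by auto
  have "2 * (- a / c) * a + (- a / c)\<^sup>2 * b \<le> 2 * (- a / c) * a + (- a / c)\<^sup>2 * c"
    using c by (intro add_left_mono mult_left_mono) auto
  also have "\<dots> = - (a\<^sup>2 / c)"
    using c(1) by (simp add: field_simps power2_eq_square)
  also have "\<dots> < 0" using \<open>a \<noteq> 0\<close> c(1) by simp
  finally show False using assms[of "- a / c"] by linarith
qed

text \<open>The Rayleigh quotient \<open>Q x x / P x x\<close> attains its maximum on the compact
  unit sphere of \<open>V\<close>. A maximizer, rescaled, is an eigenvector of \<open>Q\<close>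
  relative to \<open>P\<close>, and the maximum is the eigenvalue \<open>l\<close>.\<close>

lemma bilinear_form_eigenvector:
  fixes P Q :: "'a::euclidean_space \<Rightarrow> 'a \<Rightarrow> real"
  assumes P: "bounded_bilinear P" and Q: "bounded_bilinear Q"
    and symP: "\<And>x y. P x y = P y x" and symQ: "\<And>x y. Q x y = Q y x"
    and pos: "\<And>x. x \<noteq> 0 \<Longrightarrow> 0 < P x x"
    and V: "subspace V" "V \<noteq> {0}"
  obtains v l where "v \<in> V" "P v v = 1" "\<And>y. y \<in> V \<Longrightarrow> Q v y = l * P v y"
proof -
  interpret P: bounded_bilinear P by (rule P)
  interpret Q: bounded_bilinear Q by (rule Q)
  let ?S = "sphere 0 1 \<inter> V"
  have "compact ?S" using closed_subspace[OF V(1)] by (simp add: compact_Int_closed)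
  moreover have "?S \<noteq> {}"
  proof -
    obtain x where x: "x \<in> V" "x \<noteq> 0" using V subspace_0 by blast
    then have "(1 / norm x) *\<^sub>R x \<in> ?S" using subspace_scale[OF V(1)] by simp
    then show ?thesis by blast
  qed
  moreover have "continuous_on ?S (\<lambda>x. Q x x / P x x)"
    by (intro continuous_intros P.continuous_on Q.continuous_on ballI less_imp_neq[symmetric] pos)
      auto
  ultimately have "\<exists>u\<in>?S. \<forall>x\<in>?S. Q x x / P x x \<le> Q u u / P u u"
    by (rule continuous_attains_sup)
  then obtain u where u: "u \<in> ?S" "\<And>x. x \<in> ?S \<Longrightarrow> Q x x / P x x \<le> Q u u / P u u"
    by blast
  define l where "l = Q u u / P u u"
  have "u \<noteq> 0" using u(1) by auto
  then have u0: "P u u > 0" by (rule pos)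
  have le: "Q x x \<le> l * P x x" if "x \<in> V" for x
  proof (cases "x = 0")
    case False
    have "(1 / norm x) *\<^sub>R x \<in> ?S" using False that subspace_scale[OF V(1)] by simp
    from u(2)[OF this] have "Q x x / P x x \<le> l"
      using False by (simp add: P.scaleR_left P.scaleR_right Q.scaleR_left Q.scaleR_right l_def)
    then show ?thesis using pos[OF False] by (simp add: field_simps)
  qed (simp add: P.zero_left Q.zero_left)
  \<comment> \<open>\<open>u\<close> minimizes the form \<open>l P - Q \<ge> 0\<close> on \<open>V\<close>, so its first variation there vanishes.\<close>
  have crit: "Q u y = l * P u y" if y: "y \<in> V" for y
  proof -
    have "0 \<le> 2 * t * (l * P u y - Q u y) + t\<^sup>2 * (l * P y y - Q y y)" for t
    proof -
      have "u + t *\<^sub>R y \<in> V" using u(1) y V(1) by (simp add: subspace_add subspace_scale)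
      from le[OF this] have "Q u u + 2 * t * Q u y + t\<^sup>2 * Q y y
          \<le> l * (P u u + 2 * t * P u y + t\<^sup>2 * P y y)"
        by (simp add: P.add_left P.add_right Q.add_left Q.add_right P.scaleR_left P.scaleR_right
            Q.scaleR_left Q.scaleR_right symP[of y u] symQ[of y u] power2_eq_square algebra_simps)
      moreover have "Q u u = l * P u u" using u0 by (simp add: l_def)
      ultimately show ?thesis by (simp add: algebra_simps)
    qed
    from linear_term_zero_if_quadratic_nonneg[OF this] show ?thesis by simp
  qed
  \<comment> \<open>The eigenvector equation is linear in \<open>u\<close>, so normalizing with
    respect to \<open>P\<close> preserves it.\<close>
  define r where "r = 1 / sqrt (P u u)"
  have "r * r * P u u = 1" using u0 by (simp add: r_def)
  then show thesis
    using u(1) crit subspace_scale[OF V(1)]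
    by (intro that[of "r *\<^sub>R u" l])
       (auto simp: P.scaleR_left P.scaleR_right Q.scaleR_left algebra_simps)
qed

text \<open>Induction on \<open>S\<close>: split off a relative eigenvector and continue on its
  \<open>P\<close>-orthogonal complement in \<open>V\<close>, which has smaller dimension. The
  result is phrased as expansions of the forms rather than as an orthonormal basis, so that
  \<open>e\<close> may be padded with zero vectors when \<open>dim V < card S\<close>.\<close>

lemma simultaneous_diagonalization:
  fixes P Q :: "'a::euclidean_space \<Rightarrow> 'a \<Rightarrow> real"
  assumes P: "bounded_bilinear P" and Q: "bounded_bilinear Q"
    and symP: "\<And>x y. P x y = P y x" and symQ: "\<And>x y. Q x y = Q y x"
    and pos: "\<And>x. x \<noteq> 0 \<Longrightarrow> 0 < P x x"
    and "finite S" "subspace V" "dim V \<le> card S"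
  shows "\<exists>e c. e ` S \<subseteq> V \<and> (\<forall>x\<in>V. \<forall>y\<in>V.
    P x y = (\<Sum>s\<in>S. P (e s) x * P (e s) y) \<and>
    Q x y = (\<Sum>s\<in>S. c s * P (e s) x * P (e s) y))"
  using assms(6-)
proof (induction S arbitrary: V rule: finite_induct)
  interpret P: bounded_bilinear P by (rule P)
  interpret Q: bounded_bilinear Q by (rule Q)
  {
    case empty
    then have "V \<subseteq> {0}" by simp
    then show ?case by (auto simp: P.zero_left Q.zero_left)
  next
    case (insert s S)
    show ?case
    proof (cases "V = {0}")
      case True
      then show ?thesis by (intro exI[of _ "\<lambda>_. 0"]) (auto simp: P.zero_left Q.zero_left)
    next
      case False
      obtain v l where v: "v \<in> V" "P v v = 1" "\<And>y. y \<in> V \<Longrightarrow> Q v y = l * P v y"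
        using bilinear_form_eigenvector[OF P Q symP symQ pos insert.prems(1) False] by metis
      define W where "W = {x \<in> V. P v x = 0}"
      have W: "subspace W"
        using insert.prems(1) unfolding W_def subspace_def
        by (auto simp: P.add_right P.scaleR_right P.zero_right)
      have "v \<notin> W" "W \<subseteq> V" using v(2) unfolding W_def by auto
      then have "W \<subset> V" using v(1) by blast
      then have "dim W < dim V" using dim_psubset W insert.prems(1) by (metis span_eq_iff)
      then have "dim W \<le> card S" using insert by simp
      from insert.IH[OF W this] obtain e c where "e ` S \<subseteq> W \<and> (\<forall>x\<in>W. \<forall>y\<in>W.
          P x y = (\<Sum>s\<in>S. P (e s) x * P (e s) y) \<and>
          Q x y = (\<Sum>s\<in>S. c s * P (e s) x * P (e s) y))"
        by (elim exE)
      then have e: "e ` S \<subseteq> W"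
        and eP: "\<And>x y. x \<in> W \<Longrightarrow> y \<in> W \<Longrightarrow> P x y = (\<Sum>s\<in>S. P (e s) x * P (e s) y)"
        and eQ: "\<And>x y. x \<in> W \<Longrightarrow> y \<in> W \<Longrightarrow> Q x y = (\<Sum>s\<in>S. c s * P (e s) x * P (e s) y)"
        by simp_all
      \<comment> \<open>The \<open>P\<close>-orthogonal projection of \<open>V\<close> onto
        \<open>W\<close>; it subtracts the full component along \<open>v\<close> because
        \<open>P v v = 1\<close>.\<close>
      define w where "w x = x - P v x *\<^sub>R v" for x
      have w: "w x \<in> W" if "x \<in> V" for x
        using that v insert.prems(1)
        by (simp add: W_def w_def P.diff_right P.scaleR_right subspace_diff subspace_scale)
      have Pew: "P (e t) (w x) = P (e t) x" if "t \<in> S" for t x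
      proof -
        have "P (e t) v = 0" using that e symP[of "e t" v] unfolding W_def by auto
        then show ?thesis by (simp add: w_def P.diff_right P.scaleR_right)
      qed
      \<comment> \<open>The mixed terms vanish: \<open>P v (w x) = 0\<close> as \<open>w x\<close>
        lies in \<open>W\<close>, and then \<open>Q v (w x) = l * P v (w x) = 0\<close> as
        \<open>v\<close> is an eigenvector.\<close>
      have split: "P x y = P v x * P v y + P (w x) (w y)"
        "Q x y = l * P v x * P v y + Q (w x) (w y)" if "x \<in> V" "y \<in> V" for x y
        using v that
        by (simp_all add: w_def P.diff_left P.diff_right Q.diff_left Q.diff_right P.scaleR_left
            P.scaleR_right Q.scaleR_left Q.scaleR_right symP[of x v] symQ[of x v] algebra_simps)
      let ?e = "e(s := v)" and ?c = "c(s := l)"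
      have "?e ` insert s S \<subseteq> V" using e v(1) unfolding W_def by auto
      moreover have "P x y = (\<Sum>s\<in>insert s S. P (?e s) x * P (?e s) y)"
        "Q x y = (\<Sum>s\<in>insert s S. ?c s * P (?e s) x * P (?e s) y)"
        if xy: "x \<in> V" "y \<in> V" for x y
      proof -
        have ne: "t \<noteq> s" if "t \<in> S" for t using that insert.hyps by auto
        show "P x y = (\<Sum>s\<in>insert s S. P (?e s) x * P (?e s) y)"
          using insert.hyps ne
          by (simp add: split(1)[OF xy] eP[OF w[OF xy(1)] w[OF xy(2)]] Pew cong: sum.cong)
        show "Q x y = (\<Sum>s\<in>insert s S. ?c s * P (?e s) x * P (?e s) y)"
          using insert.hyps ne
          by (simp add: split(2)[OF xy] eQ[OF w[OF xy(1)] w[OF xy(2)]] Pew cong: sum.cong)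
      qed
      ultimately show ?thesis by blast
    qed
  }
qed

section \<open>Bilinear forms of real matrices\<close>

definition matrix_form :: "('n::finite \<Rightarrow> 'n \<Rightarrow> real) \<Rightarrow> real^'n \<Rightarrow> real^'n \<Rightarrow> real" where
  "matrix_form A x y = (\<Sum>i\<in>UNIV. \<Sum>j\<in>UNIV. A i j * x $ i * y $ j)"

lemma bounded_bilinear_matrix_form: "bounded_bilinear (matrix_form A)"
  unfolding bilinear_conv_bounded_bilinear[symmetric] bilinear_def matrix_form_def
  by (auto intro!: linearI simp: algebra_simps sum.distrib sum_distrib_left)

lemma matrix_form_commute:
  assumes "\<And>i j. A i j = A j i"
  shows "matrix_form A x y = matrix_form A y x"
  unfolding matrix_form_def
  by (subst sum.swap, intro sum.cong refl) (metis assms mult.assoc mult.commute)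

lemma matrix_form_axis: "matrix_form A (axis i 1) (axis j 1) = A i j"
  unfolding matrix_form_def
  by (simp add: axis_def if_distrib[of "\<lambda>x. _ * x"] if_distrib[of "\<lambda>x. x * _"] cong: if_cong)

section \<open>Quadratic forms as polynomials, and their matrices\<close>

text \<open>Symmetry of \<open>M\<close> is not built in: for distinct \<open>i\<close> and
  \<open>j\<close>, the monomial \<open>Var i * Var j\<close> gets the coefficient
  \<open>M i j + M j i\<close>.\<close>

definition quad :: "('n::finite \<Rightarrow> 'n \<Rightarrow> complex) \<Rightarrow> 'n cpoly" where
  "quad M = (\<Sum>i\<in>UNIV. \<Sum>j\<in>UNIV. Const (M i j) * Var i * Var j)"

lemma quad_monomial:
  "Const c * Var i * Var j =
   Poly_Mapping.single (Poly_Mapping.single i 1 + Poly_Mapping.single j 1) c"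
  by (simp add: Const_def Var_def mult_single)

lemma Const_add: "Const (a + b) = Const a + Const b"
  by (simp add: Const_def single_add)

lemma Const_mult: "Const (a * b) = Const a * Const b"
  by (simp add: Const_def mult_single)

lemma Const_sum: "Const (sum f S) = (\<Sum>s\<in>S. Const (f s))"
  by (induction S rule: infinite_finite_induct) (simp_all add: Const_add, simp_all add: Const_def)

lemma quad_add: "quad (\<lambda>i j. M i j + N i j) = quad M + quad N"
  by (simp add: quad_def Const_add algebra_simps sum.distrib)

lemma quad_transpose: "quad (\<lambda>i j. M j i) = quad M"
  unfolding quad_def by (subst sum.swap) (simp add: mult_ac)

lemma lookup_quad:
  "Poly_Mapping.lookup (quad M) m = (\<Sum>i\<in>UNIV. \<Sum>j\<in>UNIV.
     if Poly_Mapping.single i 1 + Poly_Mapping.single j 1 = m then M i j else 0)"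
  by (simp add: quad_def quad_monomial lookup_sum lookup_single when_def)

text \<open>Expanding the squares shows that an output of the network has the matrix
  \<open>a^T diag(b) a\<close>. Membership in the neuromanifold thus becomes simultaneous
  diagonalization by a common, possibly singular, \<open>a\<close>.\<close>

lemma sum_squares_eq_quad:
  "(\<Sum>s\<in>UNIV. Const (b s) * (\<Sum>j\<in>UNIV. Const (a s j) * Var j) ^ 2) =
   quad (\<lambda>i j. \<Sum>s\<in>UNIV. b s * a s i * a s j)"
proof -
  have "(\<Sum>s\<in>UNIV. Const (b s) * (\<Sum>j\<in>UNIV. Const (a s j) * Var j) ^ 2) =
    (\<Sum>s\<in>UNIV. \<Sum>i\<in>UNIV. \<Sum>j\<in>UNIV. Const (b s * a s i * a s j) * Var i * Var j)"
    by (simp add: power2_eq_square sum_product sum_distrib_left Const_mult mult_ac)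
  also have "\<dots> = (\<Sum>i\<in>UNIV. \<Sum>s\<in>UNIV. \<Sum>j\<in>UNIV. Const (b s * a s i * a s j) * Var i * Var j)"
    by (rule sum.swap)
  also have "\<dots> = (\<Sum>i\<in>UNIV. \<Sum>j\<in>UNIV. \<Sum>s\<in>UNIV. Const (b s * a s i * a s j) * Var i * Var j)"
    by (intro sum.cong refl sum.swap)
  finally show ?thesis by (simp add: quad_def Const_sum sum_distrib_right)
qed

lemma quad_in_neuromanifold:
  fixes a :: "'n::finite \<Rightarrow> 'n \<Rightarrow> complex"
  shows
  "(quad (\<lambda>i j. \<Sum>s\<in>UNIV. b s * a s i * a s j), quad (\<lambda>i j. \<Sum>s\<in>UNIV. c s * a s i * a s j))
   \<in> neuromanifold"
  unfolding neuromanifold_def mem_Collect_eq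
  by (rule exI[of _ "\<chi> s j. a s j"], rule exI[of _ "\<chi> i s. if i = 1 then b s else c s"])
     (simp add: sum_squares_eq_quad)

lemma quad_in_S2: "quad M \<in> S2"
proof -
  have "monomial_degree m = 2" if "Poly_Mapping.lookup (quad M) m \<noteq> 0" for m
  proof -
    have "\<exists>i j. Poly_Mapping.single i 1 + Poly_Mapping.single j 1 = m"
      using that unfolding lookup_quad by (rule contrapos_np) simp
    then obtain i j where "m = Poly_Mapping.single i 1 + Poly_Mapping.single j 1" by blast
    then show ?thesis
      by (simp add: monomial_degree_def lookup_add lookup_single when_def sum.distrib)
  qed
  then show ?thesis by (simp add: S2_def in_keys_iff)
qed

lemma neuromanifold_subset: "neuromanifold \<subseteq> S2 \<times> S2"
  unfolding neuromanifold_def using quad_in_S2 by (auto simp: sum_squares_eq_quad)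

text \<open>A monomial of positive degree contains some variable; removing one factor lowers the
  degree by one, and two removals leave the trivial monomial.\<close>

lemma monomial_degree_2_cases:
  assumes "monomial_degree m = 2"
  obtains i j where "m = Poly_Mapping.single i 1 + Poly_Mapping.single j 1"
proof -
  have pull: "\<exists>i. m = Poly_Mapping.single i 1 + (m - Poly_Mapping.single i 1) \<and>
      monomial_degree (m - Poly_Mapping.single i 1) = d" 
    if deg: "monomial_degree m = Suc d" for m :: "'a \<Rightarrow>\<^sub>0 nat" and d
  proof -
    obtain i where i: "Poly_Mapping.lookup m i > 0"
      using deg by (cases "\<exists>i. Poly_Mapping.lookup m i > 0") (auto simp: monomial_degree_def)
    \<comment> \<open>Subtraction of exponents is truncated, so adding back restores
      \<open>m\<close> only because \<open>i\<close> has a positive exponent.\<close>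
    have eq: "Poly_Mapping.single i 1 + (m - Poly_Mapping.single i 1) = m"
      using i by (intro poly_mapping_eqI) (auto simp: lookup_add lookup_minus lookup_single when_def)
    have "monomial_degree m = 1 + monomial_degree (m - Poly_Mapping.single i 1)"
      by (subst (1) eq[symmetric])
        (simp add: monomial_degree_def lookup_add sum.distrib lookup_single when_def)
    then show ?thesis using eq deg by (intro exI[of _ i]) simp
  qed
  obtain i m' where 1: "m = Poly_Mapping.single i 1 + m'" "monomial_degree m' = 1"
    using pull[of m 1] assms by auto
  obtain j m'' where 2: "m' = Poly_Mapping.single j 1 + m''" "monomial_degree m'' = 0"
    using pull[of m' 0] 1(2) by auto
  have "m'' = 0" using 2(2) by (intro poly_mapping_eqI) (simp add: monomial_degree_def)
  then show thesis using that 1 2 by simp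
qed

text \<open>Each monomial of degree 2 comes from a matrix with a single nonzero entry at most, and
  \<open>quad\<close> is additive. Averaging with the transpose then makes the matrix symmetric, as
  diagonalization requires of its real and imaginary parts.\<close>

lemma S2_eq_quad:
  assumes "f \<in> S2"
  obtains M where "f = quad M" "\<And>i j. M i j = M j i"
proof -
  have zero: "quad (\<lambda>_ _. 0) = 0" by (simp add: quad_def Const_def)
  have mono: "\<exists>M. Poly_Mapping.single m c = quad M" if "monomial_degree m = 2"
    for m :: "'a \<Rightarrow>\<^sub>0 nat" and c
  proof -
    obtain i j where m: "m = Poly_Mapping.single i 1 + Poly_Mapping.single j 1"
      using monomial_degree_2_cases \<open>monomial_degree m = 2\<close> .
    have "quad (\<lambda>i' j'. if i' = i \<and> j' = j then c else 0) =
        (\<Sum>i'\<in>UNIV. \<Sum>j'\<in>UNIV. if j' = j then if i' = i then Const c * Var i * Var j else 0 else 0)"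
      unfolding quad_def by (intro sum.cong refl) (auto simp: Const_def)
    also have "\<dots> = Const c * Var i * Var j" by simp
    finally show ?thesis by (metis quad_monomial m)
  qed
  have sum: "\<exists>M. (\<Sum>m\<in>K. Poly_Mapping.single m (Poly_Mapping.lookup f m)) = quad M"
    if "finite K" "\<forall>m\<in>K. monomial_degree m = 2" for K
    using that
  proof (induction K rule: finite_induct)
    case empty
    then show ?case using zero by (metis sum.empty)
  next
    case (insert m K)
    then show ?case using mono[of m "Poly_Mapping.lookup f m"] by simp (metis quad_add)
  qed
  have "f = (\<Sum>m\<in>Poly_Mapping.keys f. Poly_Mapping.single m (Poly_Mapping.lookup f m))"
    by (intro poly_mapping_eqI) (auto simp: lookup_sum lookup_single when_def in_keys_iff)
  then obtain M where M: "f = quad M"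
    using sum[of "Poly_Mapping.keys f"] assms unfolding S2_def by auto
  have "quad (\<lambda>i j. M i j / 2 + M j i / 2) = quad (\<lambda>i j. M i j / 2) + quad (\<lambda>i j. M i j / 2)"
    by (simp add: quad_add quad_transpose[of "\<lambda>i j. M i j / 2"])
  also have "\<dots> = f" by (simp add: M flip: quad_add)
  finally show thesis using that[of "\<lambda>i j. M i j / 2 + M j i / 2"] by (simp add: add.commute)
qed

section \<open>Real pairs with positive definite first component\<close>

lemma positive_definite_pair_in_neuromanifold:
  fixes A B :: "'n::finite \<Rightarrow> 'n \<Rightarrow> real"
  assumes "\<And>i j. A i j = A j i" "\<And>i j. B i j = B j i"
    and "\<And>x. x \<noteq> 0 \<Longrightarrow> 0 < matrix_form A x x"
  shows "(quad (\<lambda>i j. of_real (A i j)), quad (\<lambda>i j. of_real (B i j))) \<in> neuromanifold"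
proof -
  \<comment> \<open>The whole space has dimension \<open>CARD('n)\<close>, so the \<open>n\<close>
    hidden units suffice as index set.\<close>
  have "\<exists>(e :: 'n \<Rightarrow> real^'n) c. e ` UNIV \<subseteq> UNIV \<and> (\<forall>x\<in>UNIV. \<forall>y\<in>UNIV.
    matrix_form A x y = (\<Sum>s\<in>UNIV. matrix_form A (e s) x * matrix_form A (e s) y) \<and>
    matrix_form B x y = (\<Sum>s\<in>UNIV. c s * matrix_form A (e s) x * matrix_form A (e s) y))"
    by (intro simultaneous_diagonalization bounded_bilinear_matrix_form matrix_form_commute assms)
       auto
  then obtain e :: "'n \<Rightarrow> real^'n" and c where "\<forall>x\<in>UNIV. \<forall>y\<in>UNIV.
    matrix_form A x y = (\<Sum>s\<in>UNIV. matrix_form A (e s) x * matrix_form A (e s) y) \<and>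
    matrix_form B x y = (\<Sum>s\<in>UNIV. c s * matrix_form A (e s) x * matrix_form A (e s) y)"
    by (elim exE conjE)
  then have e: "matrix_form A x y = (\<Sum>s\<in>UNIV. matrix_form A (e s) x * matrix_form A (e s) y)"
      "matrix_form B x y = (\<Sum>s\<in>UNIV. c s * matrix_form A (e s) x * matrix_form A (e s) y)" for x y
    by blast+
  \<comment> \<open>Row \<open>s\<close> holds the coordinates of the functional
    \<open>matrix_form A (e s)\<close>. Evaluation on the standard basis gives
    \<open>A = a^T a\<close> and \<open>B = a^T diag(c) a\<close>, so the weights of the first
    output are all 1.\<close>
  define a where "a s j = matrix_form A (e s) (axis j 1)" for s j
  have "A i j = (\<Sum>s\<in>UNIV. 1 * a s i * a s j)" "B i j = (\<Sum>s\<in>UNIV. c s * a s i * a s j)" for i j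
    using e[of "axis i 1" "axis j 1"] by (simp_all add: a_def matrix_form_axis)
  then show ?thesis
    using quad_in_neuromanifold[of "\<lambda>_. 1" "\<lambda>s j. of_real (a s j)" "\<lambda>s. of_real (c s)"]
    by simp
qed

section \<open>Restriction of polynomial functions to a polynomial curve\<close>

text \<open>Along the curve \<open>g\<close> the coefficient functions are polynomials in
  \<open>z\<close>, and polynomials are closed under the sums and products that generate
  \<open>poly_fun\<close>.\<close>

lemma poly_fun_comp_poly:
  assumes "poly_fun F"
    and "\<And>m. \<exists>p. \<forall>z. Poly_Mapping.lookup (fst (g z)) m = poly p z"
    and "\<And>m. \<exists>p. \<forall>z. Poly_Mapping.lookup (snd (g z)) m = poly p z"
  shows "\<exists>p. \<forall>z. F (g z) = poly p z"
  using assms(1)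
proof induction
  case (const c)
  show ?case by (rule exI[of _ "[:c:]"]) simp
next
  case (add F G)
  then show ?case by (metis poly_add)
next
  case (mult F G)
  then show ?case by (metis poly_mult)
qed (use assms(2,3) in auto)

lemma lookup_quad_poly:
  "\<exists>p. \<forall>z. Poly_Mapping.lookup (quad (\<lambda>i j. poly (q i j) z)) m = poly p z"
  by (rule exI[of _ "\<Sum>i\<in>UNIV. \<Sum>j\<in>UNIV.
        if Poly_Mapping.single i 1 + Poly_Mapping.single j 1 = m then q i j else 0"])
     (simp add: lookup_quad poly_sum if_distrib[of "\<lambda>p. poly p _"] cong: if_cong)

lemma identity_perturbation_positive_definite:
  fixes Y Z :: "'n::finite \<Rightarrow> 'n \<Rightarrow> real"
  obtains d where "d > 0"
    "\<And>t x. \<bar>t\<bar> < d \<Longrightarrow> x \<noteq> 0 \<Longrightarrow>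
      0 < matrix_form (\<lambda>i j. (if i = j then 1 else 0) + t * Y i j + t\<^sup>2 * Z i j) x x"
proof -
  obtain K L where K: "K > 0" "\<And>x y. norm (matrix_form Y x y) \<le> norm x * norm y * K"
    and L: "L > 0" "\<And>x y. norm (matrix_form Z x y) \<le> norm x * norm y * L"
    using bounded_bilinear.pos_bounded[OF bounded_bilinear_matrix_form] by metis
  \<comment> \<open>The summand 1 forces \<open>d \<le> 1\<close>, hence
    \<open>t\<^sup>2 \<le> \<bar>t\<bar>\<close> below. Both perturbation terms together are then at
    most \<open>\<bar>t\<bar> * (K + L) * ?N\<close>, which is less than \<open>?N\<close>.\<close>
  define d where "d = 1 / (1 + K + L)"
  have d: "d > 0" "d \<le> 1" using K(1) L(1) by (auto simp: d_def field_simps)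
  show thesis
  proof (rule that[OF d(1)])
    fix t :: real and x :: "real^'n"
    assume t: "\<bar>t\<bar> < d" and x: "x \<noteq> 0"
    let ?N = "norm x * norm x"
    have N: "?N > 0" using x by simp
    have eq: "matrix_form (\<lambda>i j. (if i = j then 1 else 0) + t * Y i j + t\<^sup>2 * Z i j) x x =
        ?N + t * matrix_form Y x x + t\<^sup>2 * matrix_form Z x x"
    proof -
      have "?N = (\<Sum>i\<in>UNIV. x $ i * x $ i)"
        by (metis inner_vec_def inner_real_def power2_eq_square power2_norm_eq_inner)
      also have "\<dots> = matrix_form (\<lambda>i j. if i = j then 1 else 0) x x"
        unfolding matrix_form_def by (simp add: if_distrib[of "\<lambda>x. x * _"] cong: if_cong)
      finally show ?thesis
        by (simp add: matrix_form_def algebra_simps sum.distrib sum_distrib_left)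
    qed
    have "\<bar>t * matrix_form Y x x\<bar> \<le> \<bar>t\<bar> * (?N * K)"
      unfolding abs_mult using K(2)[of x x] by (intro mult_left_mono) auto
    moreover have "\<bar>t\<^sup>2 * matrix_form Z x x\<bar> \<le> \<bar>t\<bar> * (?N * L)"
      unfolding abs_mult
    proof (intro mult_mono)
      show "\<bar>t\<^sup>2\<bar> \<le> \<bar>t\<bar>" using t d(2) mult_left_le[of "\<bar>t\<bar>" "\<bar>t\<bar>"]
        by (simp add: power2_eq_square)
    qed (use L(2)[of x x] in auto)
    moreover have "\<bar>t\<bar> * (?N * K) + \<bar>t\<bar> * (?N * L) < ?N"
    proof -
      have "\<bar>t\<bar> * (1 + K + L) < 1" using t K(1) L(1) by (simp add: d_def field_simps)
      then have "\<bar>t\<bar> * (K + L) < 1" by (simp add: algebra_simps)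
      then have "?N * (\<bar>t\<bar> * (K + L)) < ?N * 1" using N by (intro mult_strict_left_mono)
      then show ?thesis by (simp add: algebra_simps)
    qed
    ultimately show "0 < matrix_form (\<lambda>i j. (if i = j then 1 else 0) + t * Y i j + t\<^sup>2 * Z i j) x x"
      unfolding eq by linarith
  qed
qed

lemma poly_fun_vanishing_on_neuromanifold:
  fixes F :: "('n::finite) cpoly \<times> 'n cpoly \<Rightarrow> complex"
  assumes F: "poly_fun F" and vanish: "\<And>p. p \<in> neuromanifold \<Longrightarrow> F p = 0"
    and "f \<in> S2" "h \<in> S2"
  shows "F (f, h) = 0"
proof -
  obtain M N where M: "f = quad M" "\<And>i j. M i j = M j i" and N: "h = quad N" "\<And>i j. N i j = N j i"
    using S2_eq_quad assms(3,4) by metis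
  define \<delta> :: "'n \<Rightarrow> 'n \<Rightarrow> real" where "\<delta> i j = (if i = j then 1 else 0)" for i j
  \<comment> \<open>Real coefficients are chosen so that substituting \<open>\<i>\<close> for
    \<open>t\<close> cancels the two \<open>\<delta>\<close> terms and yields
    \<open>Re (M i j) + \<i> * Im (M i j)\<close>; the constant term \<open>\<delta>\<close> keeps
    \<open>A t\<close> positive definite for small \<open>t\<close>. \<open>B\<close> is built
    likewise but needs no definiteness.\<close>
  define A where "A t i j = \<delta> i j + t * Im (M i j) + t\<^sup>2 * (\<delta> i j - Re (M i j))" for t i j
  define B where "B t i j = t * Im (N i j) - t\<^sup>2 * Re (N i j)" for t i j
  define p where "p i j =
    [:of_real (\<delta> i j), of_real (Im (M i j)), of_real (\<delta> i j - Re (M i j)) :: complex:]" for i j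
  define q where "q i j = [:0, of_real (Im (N i j)), - of_real (Re (N i j)) :: complex:]" for i j
  define g where "g z = (quad (\<lambda>i j. poly (p i j) z), quad (\<lambda>i j. poly (q i j) z))" for z
  obtain r where r: "\<And>z. F (g z) = poly r z"
    using poly_fun_comp_poly[OF F, of g] lookup_quad_poly unfolding g_def fst_conv snd_conv by metis
  have "poly (p i j) \<i> = M i j" "poly (q i j) \<i> = N i j" for i j
    by (simp_all add: p_def q_def complex_eq_iff algebra_simps)
  then have gi: "g \<i> = (f, h)" by (simp add: g_def M(1) N(1))
  have real: "poly (p i j) (of_real t) = of_real (A t i j)"
    "poly (q i j) (of_real t) = of_real (B t i j)" for i j t
    by (simp_all add: p_def q_def A_def B_def algebra_simps power2_eq_square)
  obtain d where d: "d > 0" "\<And>t x. \<bar>t\<bar> < d \<Longrightarrow> x \<noteq> 0 \<Longrightarrow> 0 < matrix_form (A t) x x"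
    using identity_perturbation_positive_definite[of "\<lambda>i j. Im (M i j)" "\<lambda>i j. \<delta> i j - Re (M i j)"]
    unfolding A_def[abs_def] \<delta>_def by blast
  have sym: "A t i j = A t j i" "B t i j = B t j i" for t i j
    using M(2)[of i j] N(2)[of i j] by (auto simp: A_def B_def \<delta>_def)
  have "poly r (of_real t) = 0" if "t \<in> {0<..<d}" for t
    using that vanish[OF positive_definite_pair_in_neuromanifold[of "A t" "B t"]] d(2)[of t] sym
    by (simp add: g_def real flip: r)
  \<comment> \<open>An interval of real zeros forces \<open>r = 0\<close>, which carries the
    vanishing over to the non-real point \<open>\<i>\<close>.\<close>
  then have "of_real ` {0<..<d} \<subseteq> {z. poly r z = 0}" by auto
  moreover have "infinite (complex_of_real ` {0<..<d})"
    using d(1) by (simp add: finite_image_iff inj_on_def)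
  ultimately have "r = 0" using poly_roots_finite finite_subset by blast
  then show ?thesis using r[of \<i>] gi by simp
qed

theorem theorem3p5:
  "zariski closure_of (neuromanifold :: (('n::finite) cpoly \<times> 'n cpoly) set) = S2 \<times> S2"
proof
  show "zariski closure_of (neuromanifold :: ('n cpoly \<times> 'n cpoly) set) \<subseteq> S2 \<times> S2"
    using closure_of_subset_topspace[of zariski] by (simp add: topspace_zariski)
  \<comment> \<open>Being closed, the closure is cut out by some family of polynomial functions.
    Each of them vanishes on the neuromanifold, hence on all of \<open>S2 \<times> S2\<close>, so
    the family imposes no condition.\<close>
  have "zariski_closed (zariski closure_of (neuromanifold :: ('n cpoly \<times> 'n cpoly) set))"
    using closedin_closure_of closedin_zariski by blast
  then obtain \<F> where F: "\<forall>F\<in>\<F>. poly_fun F"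
    and eq: "zariski closure_of (neuromanifold :: ('n cpoly \<times> 'n cpoly) set) = zero_locus \<F>"
    unfolding zariski_closed_def by blast
  have "neuromanifold \<subseteq> zero_locus \<F>"
    using closure_of_subset[of "neuromanifold :: ('n cpoly \<times> 'n cpoly) set" zariski]
      neuromanifold_subset
    by (simp add: topspace_zariski eq)
  then have "F p = 0" if "F \<in> \<F>" "p \<in> neuromanifold" for F p
    using that unfolding zero_locus_def by blast
  then show "S2 \<times> S2 \<subseteq> zariski closure_of (neuromanifold :: ('n cpoly \<times> 'n cpoly) set)"
    unfolding eq zero_locus_def using poly_fun_vanishing_on_neuromanifold F by blast
qed

end
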